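(* Let $q$ be an odd prime power, let $n$ be a positive integer, and let $F_q$ be the field with $q$ elements. Let $\mathcal{F} \subseteq \mathrm{sub}(F_q^n)$ be a family of subspaces such that $\dim(A)$ is even for all $A \in \mathcal{F}$ and $\dim(A \cap B)$ is odd for all $A, B \in \mathcal{F}$ with $A \neq B$. Then $|\mathcal{F}| \leq [n]_q$ when $n$ is odd, and $|\mathcal{F}| \leq [n]_q - 1$ when $n$ is even.
   Context: $\mathrm{sub}(F_q^n)$ denotes the set of all linear subspaces of the $n$-dimensional vector space $F_q^n$ over $F_q$. For a positive integer $n$, $[n]_q := \frac{1-q^n}{1-q} = 1 + q + q^2 + \cdots + q^{n-1}$. The number $0$ is even. *)

theory Defs
  imports "HOL-Analysis.Analysis" "HOL-Number_Theory.Prime_Powers"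
begin

definition q_bracket :: "real \<Rightarrow> nat \<Rightarrow> real"
  where "q_bracket q n = (1 - q ^ n) / (1 - q)"

(* The quotient above is a junk value at q = 1; away from it, it is the geometric sum. *)
lemma q_bracket_eq_sum: "q \<noteq> 1 \<Longrightarrow> q_bracket q n = (\<Sum>i<n. q ^ i)"
  by (simp add: q_bracket_def sum_gp_strict)

(* The locale instance vec is the vector-space structure of 'k ^ 'n over an arbitrary
   field 'k; the unqualified subspace and dim would be those over the reals. *)
definition sub :: "('k::field ^ 'n::finite) set set"
  where "sub = {A. vec.subspace A}"

end

theory Submission
  imports Defs
begin

text \<open>
  Replace each subspace by the set of one-dimensional subspaces it contains. A subspace of dimension
  \<open>d\<close> contains \<open>1 + q + \<dots> + q ^ (d - 1)\<close> of them, which for odd \<open>q\<close> has the parity of \<open>d\<close>.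
  Hence the family becomes a family of even sets with pairwise odd intersections in a universe of
  \<open>[n]\<^sub>q\<close> points, to which the reverse oddtown bound applies. If such a family has even size \<open>m\<close>, its
  characteristic vectors over the field with two elements are linearly independent, and they lie in
  the hyperplane of even vectors, so \<open>2 ^ m\<close> is at most half the number of subsets of the universe.
  A family of odd size loses one member first.
\<close>

section \<open>Reverse oddtown for families of finite sets\<close>

text \<open>Membership of \<open>i\<close> flips the parity of \<open>S - {i}\<close>, so one index
  where \<open>S\<close> and \<open>T\<close> differ gives \<open>S\<close> and \<open>T\<close>
  opposite parities, and then they differ at every index. Being complementary in \<open>I\<close>,
  they would make \<open>card I\<close> odd. Over the field with two elements this says that the
  matrix of even order with zeros on the diagonal and ones elsewhere is invertible.\<close>

lemma parity_eq_imp_eq: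
  assumes "finite I" "even (card I)" "S \<subseteq> I" "T \<subseteq> I"
    and par: "\<And>i. i \<in> I \<Longrightarrow> even (card (S - {i})) \<longleftrightarrow> even (card (T - {i}))"
  shows "S = T"
proof (rule ccontr)
  assume "S \<noteq> T"
  have fin: "finite S" "finite T"
    using assms finite_subset by blast+
  have iff: "(even (card S) \<longleftrightarrow> even (card T)) \<longleftrightarrow> (i \<in> S \<longleftrightarrow> i \<in> T)" if "i \<in> I" for i
  proof -
    have *: "even (card (U - {i})) \<longleftrightarrow> (even (card U) \<longleftrightarrow> i \<notin> U)" if "finite U" for U
    proof (cases "i \<in> U")
      case True
      then have "card U = Suc (card (U - {i}))"
        using that by (rule card.remove[rotated])
      with True show ?thesis by simp
    qed simp
    show ?thesis
      using par[OF that] *[OF fin(1)] *[OF fin(2)] by blast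
  qed
  from \<open>S \<noteq> T\<close> obtain i where "i \<in> I" "i \<in> S \<longleftrightarrow> i \<notin> T"
    using assms by blast
  with iff have opp: "even (card S) \<longleftrightarrow> odd (card T)"
    by blast
  with iff have "I = S \<union> T" "S \<inter> T = {}"
    using assms by blast+
  then have "card I = card S + card T"
    using fin by (simp add: card_Un_disjoint)
  with opp \<open>even (card I)\<close> show False
    by simp
qed

text \<open>Linear independence takes the form of injectivity of
  \<open>\<lambda>S. D S - {x}\<close> on \<open>Pow I\<close>; comparing the two power sets then
  bounds \<open>card I\<close> by \<open>card (X - {x})\<close>.\<close>

lemma reverse_oddtown_even:
  fixes P :: "'i \<Rightarrow> 'a set"
  assumes X: "finite X" "X \<noteq> {}" and I: "finite I" "even (card I)"
    and sub: "\<And>i. i \<in> I \<Longrightarrow> P i \<subseteq> X"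
    and ev: "\<And>i. i \<in> I \<Longrightarrow> even (card (P i))"
    and od: "\<And>i j. i \<in> I \<Longrightarrow> j \<in> I \<Longrightarrow> i \<noteq> j \<Longrightarrow> odd (card (P i \<inter> P j))"
  shows "card I < card X"
proof -
  obtain x where x: "x \<in> X" using X by blast
  \<comment> \<open>The sum modulo 2 of the characteristic vectors of the members of \<open>S\<close>. Since \<open>D S\<close> is even, it is
    determined by its part outside \<open>x\<close>.\<close>
  define D where "D S = {p \<in> X. odd (card {i \<in> S. p \<in> P i})}" for S
  \<comment> \<open>Linearity of the inner product with \<open>Y\<close> modulo 2, by double
    counting the pairs of \<open>i \<in> S\<close> and
    \<open>p \<in> P i \<inter> Y\<close>.\<close>
  have count: "even (card (D S \<inter> Y)) \<longleftrightarrow> even (card {i \<in> S. odd (card (P i \<inter> Y))})"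
    if "S \<subseteq> I" "Y \<subseteq> X" for S Y
  proof -
    have fin: "finite S" "finite Y"
      using that X I finite_subset by blast+
    have "(\<Sum>p\<in>Y. card {i \<in> S. p \<in> P i}) = (\<Sum>i\<in>S. card {p \<in> Y. p \<in> P i})"
      using fin by (intro sum_multicount_gen) auto
    also have "\<dots> = (\<Sum>i\<in>S. card (P i \<inter> Y))"
      by (intro sum.cong arg_cong[where f = card]) auto
    finally have "even (card {p \<in> Y. odd (card {i \<in> S. p \<in> P i})})
        \<longleftrightarrow> even (card {i \<in> S. odd (card (P i \<inter> Y))})"
      by (simp only: even_sum_iff[OF fin(2), symmetric] even_sum_iff[OF fin(1), symmetric])
    moreover have "{p \<in> Y. odd (card {i \<in> S. p \<in> P i})} = D S \<inter> Y"
      using that by (auto simp: D_def)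
    ultimately show ?thesis by simp
  qed
  have even_D: "even (card (D S))" if "S \<subseteq> I" for S
  proof -
    have "{i \<in> S. odd (card (P i \<inter> X))} = {}"
      using that ev sub by (auto simp: Int_absorb2 subset_iff)
    moreover have "D S \<inter> X = D S"
      by (auto simp: D_def)
    ultimately show ?thesis
      using count[OF that order_refl] by (simp only: card.empty even_zero)
  qed
  have "inj_on (\<lambda>S. D S - {x}) (Pow I)"
  proof (rule inj_onI)
    fix S T
    assume ST: "S \<in> Pow I" "T \<in> Pow I" and eq: "D S - {x} = D T - {x}"
    have "x \<in> D U \<longleftrightarrow> odd (card (D U - {x}))" if "U \<subseteq> I" for U
    proof (cases "x \<in> D U")
      case True
      have "finite (D U)" using X by (simp add: D_def)
      then have "card (D U) = Suc (card (D U - {x}))"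
        using True by (rule card.remove)
      with True even_D[OF that] show ?thesis
        by (metis even_Suc)
    qed (use even_D[OF that] in simp)
    with ST eq have "x \<in> D S \<longleftrightarrow> x \<in> D T"
      by (metis PowD)
    with eq have eq': "D S = D T"
      by blast
    \<comment> \<open>Pairing \<open>D U\<close> with \<open>P i\<close> counts the
      \<open>j \<in> U\<close> for which \<open>P j\<close> meets \<open>P i\<close> in an odd set,
      which are those other than \<open>i\<close>.\<close>
    have *: "even (card (D U \<inter> P i)) \<longleftrightarrow> even (card (U - {i}))" if "U \<subseteq> I" "i \<in> I" for U i
    proof -
      have "{j \<in> U. odd (card (P j \<inter> P i))} = U - {i}"
        using that od ev by (auto simp: subset_iff)
      then show ?thesis
        using count[OF that(1) sub[OF that(2)]] by (simp only:)
    qed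
    show "S = T"
    proof (rule parity_eq_imp_eq[OF I])
      show "even (card (S - {i})) \<longleftrightarrow> even (card (T - {i}))" if "i \<in> I" for i
        using *[of S i] *[of T i] ST that eq' by simp
    qed (use ST in auto)
  qed
  moreover have "(\<lambda>S. D S - {x}) ` Pow I \<subseteq> Pow (X - {x})"
    by (auto simp: D_def)
  ultimately have "card (Pow I) \<le> card (Pow (X - {x}))"
    using X by (intro card_inj_on_le) auto
  then have "card I \<le> card (X - {x})"
    using X I by (simp add: card_Pow)
  also have "\<dots> < card X"
    using X x by (intro card_Diff1_less)
  finally show ?thesis .
qed

lemma reverse_oddtown:
  fixes P :: "'i \<Rightarrow> 'a set"
  assumes X: "finite X" "X \<noteq> {}" and I: "finite I"
    and sub: "\<And>i. i \<in> I \<Longrightarrow> P i \<subseteq> X"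
    and ev: "\<And>i. i \<in> I \<Longrightarrow> even (card (P i))"
    and od: "\<And>i j. i \<in> I \<Longrightarrow> j \<in> I \<Longrightarrow> i \<noteq> j \<Longrightarrow> odd (card (P i \<inter> P j))"
  shows "card I \<le> card X" "even (card X) \<Longrightarrow> card I < card X"
proof -
  \<comment> \<open>The parity of \<open>card I\<close> is kept because equality is left open only
    for odd \<open>card I\<close>, which an even \<open>card X\<close> excludes.\<close>
  have "card I < card X \<or> odd (card I) \<and> card I \<le> card X"
  proof (cases "even (card I)")
    case True
    then show ?thesis
      using reverse_oddtown_even[where P = P, OF X I True sub ev od] by blast
  next
    case False
    then obtain i where i: "i \<in> I"
      by fastforce
    have card: "card I = Suc (card (I - {i}))"
      using I i by (rule card.remove)
    have "card (I - {i}) < card X"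
      by (rule reverse_oddtown_even[where P = P]) (use X I sub ev od card False in auto)
    with card False show ?thesis
      by simp
  qed
  then show "card I \<le> card X" "even (card X) \<Longrightarrow> card I < card X"
    by (auto simp: le_less)
qed

section \<open>Counting vectors and one-dimensional subspaces over a finite field\<close>

lemma (in vector_space) card_span_independent:
  assumes "finite B" "independent B" "finite (UNIV :: 'a set)"
  shows "card (span B) = CARD('a) ^ card B"
  using assms(1,2)
proof (induction B rule: finite_induct)
  case empty
  then show ?case by simp
next
  case (insert b B)
  have indep: "independent B" "b \<notin> span B"
    using insert.prems insert.hyps by (simp_all add: independent_insert)
  have "bij_betw (\<lambda>(k, v). scale k b + v) (UNIV \<times> span B) (span (insert b B))"
    unfolding bij_betw_def
  proof
    show "inj_on (\<lambda>(k, v). scale k b + v) (UNIV \<times> span B)"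
    proof (rule inj_onI, clarify)
      fix k l v w
      assume vw: "v \<in> span B" "w \<in> span B" and eq: "scale k b + v = scale l b + w"
      then have "scale (k - l) b = w - v"
        by (simp add: scale_left_diff_distrib algebra_simps)
      then have "scale (k - l) b \<in> span B"
        using vw by (simp add: span_diff)
      \<comment> \<open>For \<open>k \<noteq> l\<close> this vector is \<open>b\<close>, which lies
        outside \<open>span B\<close>; for \<open>k = l\<close> it is merely zero.\<close>
      then have "scale (inverse (k - l)) (scale (k - l) b) \<in> span B"
        by (rule span_scale)
      then have "k = l"
        using indep(2) by (cases "k = l") auto
      with eq show "k = l \<and> v = w" by simp
    qed
    show "(\<lambda>(k, v). scale k b + v) ` (UNIV \<times> span B) = span (insert b B)"
    proof (intro set_eqI iffI)
      fix x assume "x \<in> span (insert b B)"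
      then obtain k where "x - scale k b \<in> span B"
        by (auto simp: span_insert)
      then show "x \<in> (\<lambda>(k, v). scale k b + v) ` (UNIV \<times> span B)"
        by (intro image_eqI[where x = "(k, x - scale k b)"]) auto
    next
      fix x assume "x \<in> (\<lambda>(k, v). scale k b + v) ` (UNIV \<times> span B)"
      then obtain k v where "x = scale k b + v" "v \<in> span B"
        by auto
      then show "x \<in> span (insert b B)"
        by (auto simp: span_insert intro!: exI[of _ k])
    qed
  qed
  then have "card (span (insert b B)) = CARD('a) * card (span B)"
    by (metis bij_betw_same_card card_cartesian_product)
  with insert indep show ?case by simp
qed

text \<open>For a subspace \<open>A\<close> these are the points of its projective space. Stating it
  through inclusion in \<open>A\<close> makes it commute with intersections of arbitrary
  sets.\<close>

definition lines_in :: "('k::field ^ 'n) set \<Rightarrow> ('k ^ 'n) set set"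
  where "lines_in A = {L. L \<subseteq> A \<and> (\<exists>v. v \<noteq> 0 \<and> L = vec.span {v})}"

lemma card_subspace:
  fixes A :: "('k::{field,finite} ^ 'n) set"
  assumes "vec.subspace A"
  shows "card A = CARD('k) ^ vec.dim A"
proof -
  obtain B where B: "B \<subseteq> A" "vec.independent B" "A \<subseteq> vec.span B" "card B = vec.dim A"
    using vec.basis_exists by blast
  have "vec.span B = A"
    using B assms by (simp add: vec.span_subspace)
  with B show ?thesis
    using vec.card_span_independent[of B] vec.finiteI_independent by simp
qed

lemma lines_in_Int: "lines_in (A \<inter> B) = lines_in A \<inter> lines_in B"
  by (auto simp: lines_in_def)

text \<open>The one-dimensional subspaces of \<open>A\<close>, with zero removed, partition
  \<open>A - {0}\<close> into blocks of \<open>CARD('k) - 1\<close> vectors each.\<close>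

lemma card_lines_in:
  fixes A :: "('k::{field,finite} ^ 'n) set"
  assumes A: "vec.subspace A"
  shows "card (lines_in A) = (\<Sum>i<vec.dim A. CARD('k) ^ i)"
proof -
  let ?q = "CARD('k)"
  have q: "?q > 1"
    using card_mono[of UNIV "{0, 1 :: 'k}"] by simp
  have card_line: "card (L - {0}) = ?q - 1" if L: "L \<in> lines_in A" for L
  proof -
    obtain v where v: "v \<noteq> 0" "L = vec.span {v}"
      using L by (auto simp: lines_in_def)
    then have "card L = ?q"
      using vec.card_span_independent[of "{v}"] by simp
    moreover have "0 \<in> L"
      using v vec.span_zero by simp
    ultimately show ?thesis
      by (simp add: card_Diff_singleton)
  qed
  \<comment> \<open>Any nonzero vector of a line spans it, so two distinct lines share only
    zero.\<close>
  have span_eq: "vec.span {v} = vec.span {w}"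
    if w: "w \<in> vec.span {v}" "w \<noteq> 0" for v w :: "'k ^ 'n"
  proof -
    obtain c where c: "w = c *s v"
      using w(1) by (auto simp: vec.span_singleton)
    with w(2) have "v = inverse c *s w"
      by auto
    with c have "v \<in> vec.span {w}"
      by (metis vec.span_base vec.span_scale singletonI)
    with w(1) show ?thesis
      by (simp add: vec.span_eq)
  qed
  have disj: "(L - {0}) \<inter> (M - {0}) = {}"
    if "L \<in> lines_in A" "M \<in> lines_in A" "L \<noteq> M" for L M
  proof (rule ccontr)
    assume "(L - {0}) \<inter> (M - {0}) \<noteq> {}"
    then obtain w where w: "w \<in> L" "w \<in> M" "w \<noteq> 0"
      by blast
    have "N = vec.span {w}" if "N \<in> lines_in A" "w \<in> N" for N
      using that span_eq[OF _ w(3)] by (auto simp: lines_in_def)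
    with that w show False
      by metis
  qed
  have un: "(\<Union>L\<in>lines_in A. L - {0}) = A - {0}"
  proof (intro equalityI subsetI)
    fix w assume "w \<in> (\<Union>L\<in>lines_in A. L - {0})"
    then show "w \<in> A - {0}"
      by (auto simp: lines_in_def)
  next
    fix w assume w: "w \<in> A - {0}"
    then have "vec.span {w} \<in> lines_in A"
      using vec.span_minimal[OF _ A, of "{w}"] by (auto simp: lines_in_def)
    moreover have "w \<in> vec.span {w} - {0}"
      using w vec.span_base[of w "{w}"] by simp
    ultimately show "w \<in> (\<Union>L\<in>lines_in A. L - {0})"
      by blast
  qed
  have "card (A - {0}) = (\<Sum>L\<in>lines_in A. card (L - {0}))"
    unfolding un[symmetric] by (intro card_UN_disjoint) (use disj in auto)
  also have "\<dots> = (?q - 1) * card (lines_in A)"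
    using card_line by simp
  finally have "(?q - 1) * card (lines_in A) = ?q ^ vec.dim A - 1"
    using vec.subspace_0[OF A] card_subspace[OF A] by (simp add: card_Diff_singleton)
  also have "\<dots> = (?q - 1) * (\<Sum>i<vec.dim A. ?q ^ i)"
  proof -
    \<comment> \<open>The successor form keeps truncated subtraction out of the induction for the
      geometric sum.\<close>
    obtain m where m: "?q = Suc m"
      using q not0_implies_Suc by fastforce
    have geo: "Suc m ^ d = Suc (m * (\<Sum>i<d. Suc m ^ i))" for d
      by (induction d) (simp_all add: algebra_simps)
    show ?thesis
      unfolding m geo[of "vec.dim A"] by simp
  qed
  finally show ?thesis
    using q by simp
qed

lemma even_card_lines_in:
  fixes A :: "('k::{field,finite} ^ 'n) set"
  assumes "vec.subspace A" "odd CARD('k)"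
  shows "even (card (lines_in A)) \<longleftrightarrow> even (vec.dim A)"
  using assms by (simp add: card_lines_in even_sum_iff)

section \<open>From subspaces to sets of points\<close>

theorem theorem1p6:
  fixes q n :: nat
    and \<F> :: "('k::{field,finite} ^ 'n::finite) set set"
  assumes "primepow q" and "odd q"
    and "CARD('k) = q" and "CARD('n) = n"
    and "\<F> \<subseteq> sub"
    and "\<And>A. A \<in> \<F> \<Longrightarrow> even (vec.dim A)"
    and "\<And>A B. A \<in> \<F> \<Longrightarrow> B \<in> \<F> \<Longrightarrow> A \<noteq> B \<Longrightarrow> odd (vec.dim (A \<inter> B))"
  shows "(odd n \<longrightarrow> real (card \<F>) \<le> q_bracket (real q) n) \<and>
         (even n \<longrightarrow> real (card \<F>) \<le> q_bracket (real q) n - 1)"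
proof -
  let ?X = "lines_in (UNIV :: ('k ^ 'n) set)"
  have sub: "vec.subspace A" if "A \<in> \<F>" for A
    using that assms by (auto simp: sub_def)
  \<comment> \<open>This avoids the junk value of \<open>q_bracket\<close> at 1.\<close>
  have "q > 1"
    using assms by (simp add: primepow_gt_Suc_0)
  have card_X: "card ?X = (\<Sum>i<n. q ^ i)"
    using assms by (simp add: card_lines_in vec_dim_card del: vec.dim_UNIV)
  with \<open>q > 1\<close> have bracket: "q_bracket (real q) n = real (card ?X)"
    by (simp add: q_bracket_eq_sum)
  have parity: "even (card ?X) \<longleftrightarrow> even n"
    using assms by (simp add: card_X even_sum_iff)
  have X: "finite ?X" "?X \<noteq> {}"
  proof -
    \<comment> \<open>The all-ones vector is nonzero because the index type is inhabited.\<close>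
    have "(1 :: 'k ^ 'n) \<noteq> 0"
      by (simp add: vec_eq_iff)
    then have "vec.span {1} \<in> ?X"
      unfolding lines_in_def by blast
    then show "?X \<noteq> {}"
      by blast
  qed simp
  have P: "lines_in A \<subseteq> ?X" for A
    by (auto simp: lines_in_def)
  have even_P: "even (card (lines_in A))" if "A \<in> \<F>" for A
    using that sub assms by (simp add: even_card_lines_in)
  have PP: "odd (card (lines_in A \<inter> lines_in B))" if "A \<in> \<F>" "B \<in> \<F>" "A \<noteq> B" for A B
    using that sub assms
    by (simp flip: lines_in_Int add: even_card_lines_in vec.subspace_inter)
  note bound = reverse_oddtown[where P = lines_in, OF X finite P even_P PP]
  \<comment> \<open>For even \<open>n\<close> the number of points is even, so the bound is strict;
    between integers this is the subtracted 1.\<close>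
  have "card \<F> \<le> card ?X" "even n \<Longrightarrow> card \<F> < card ?X"
    using bound parity by blast+
  then show ?thesis
    unfolding bracket by auto
qed

end
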